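(* Let $H$ be a complex Hilbert space, let $\delta\in(0,1]$, and let $\mathcal S_\delta$ be a $C_0$--$\delta$--semigroup on $H$ with $\delta$-generator $\mathcal A_\delta$. Assume that $\mathcal A_\delta$ is densely defined, dissipative, and that $$\mathrm{Ran}(\lambda I-\mathcal A_\delta)=H\quad\text{for some }\lambda>0.$$ Then $\mathcal S_\delta$ is contractive: $\|\mathcal S_\delta(t)\|\le 1$ for all $t\ge0$.
   Context: A family $\{\mathcal S_\delta(t)\}_{t\ge0}$ of bounded linear operators on $H$ is a conformable $\delta$--semigroup if $\mathcal S_\delta(0)=\mathrm{Id}$ and $\mathcal S_\delta((r+q)^{1/\delta})=\mathcal S_\delta(r^{1/\delta})\,\mathcal S_\delta(q^{1/\delta})$ for all $r,q\ge 0$. It is a $C_0$--$\delta$--semigroup if in addition $\lim_{t\to0^+}\mathcal S_\delta(t)x=x$ for all $x\in H$. The conformable derivative is $\mathcal D_t^\delta v(t)=\lim_{h\to0}\frac{v(t+h\,t^{1-\delta})-v(t)}{h}$, $t>0$. The $\delta$-generator of $\mathcal S_\delta$ is $\mathcal A_\delta x=\lim_{t\to0^+}\mathcal D_t^\delta\mathcal S_\delta(t)x$, with domain $D(\mathcal A_\delta)$ the set of $x\in H$ for which this limit exists (including existence of $\mathcal D_t^\delta\mathcal S_\delta(t)x$ for all small $t>0$). A densely defined operator $B:D(B)\subset H\to H$ is dissipative if $\mathrm{Re}\langle Bx,x\rangle\le0$ for all $x\in D(B)$. *)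

theory Defs
  imports "HOL-Analysis.Analysis"
begin

section \<open>Complex Hilbert spaces\<close>

class complex_vector = real_vector +
  fixes scaleC :: "complex \<Rightarrow> 'a \<Rightarrow> 'a" (infixr "*\<^sub>C" 75)
  assumes scaleC_add_right: "c *\<^sub>C (x + y) = c *\<^sub>C x + c *\<^sub>C y"
    and scaleC_add_left: "(c + d) *\<^sub>C x = c *\<^sub>C x + d *\<^sub>C x"
    and scaleC_scaleC: "c *\<^sub>C (d *\<^sub>C x) = (c * d) *\<^sub>C x"
    and scaleC_one: "1 *\<^sub>C x = x"
    and scaleR_scaleC: "r *\<^sub>R x = complex_of_real r *\<^sub>C x"

text \<open>The inner product is linear in its first argument and conjugate-linear in its second.\<close>

class complex_inner = complex_vector + real_normed_vector +
  fixes cinner :: "'a \<Rightarrow> 'a \<Rightarrow> complex"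
  assumes cinner_commute: "cinner x y = cnj (cinner y x)"
    and cinner_add_left: "cinner (x + y) z = cinner x z + cinner y z"
    and cinner_scaleC_left: "cinner (c *\<^sub>C x) y = c * cinner x y"
    and cinner_ge_zero: "0 \<le> Re (cinner x x)"
    and cinner_eq_zero_iff: "cinner x x = 0 \<longleftrightarrow> x = 0"
    and norm_eq_sqrt_cinner: "norm x = sqrt (Re (cinner x x))"

class complex_hilbert_space = complex_inner + banach

instantiation complex :: complex_hilbert_space
begin

definition scaleC_complex :: "complex \<Rightarrow> complex \<Rightarrow> complex"
  where "scaleC_complex c x = c * x"

definition cinner_complex :: "complex \<Rightarrow> complex \<Rightarrow> complex"
  where "cinner_complex x y = x * cnj y"

instance
proof
  fix c d x y z :: complex and r :: real
  show "c *\<^sub>C (x + y) = c *\<^sub>C x + c *\<^sub>C y"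
    and "(c + d) *\<^sub>C x = c *\<^sub>C x + d *\<^sub>C x"
    and "c *\<^sub>C (d *\<^sub>C x) = (c * d) *\<^sub>C x"
    and "1 *\<^sub>C x = x"
    by (simp_all add: scaleC_complex_def algebra_simps)
  show "r *\<^sub>R x = complex_of_real r *\<^sub>C x"
    by (simp add: scaleC_complex_def scaleR_conv_of_real)
  show "cinner x y = cnj (cinner y x)"
    and "cinner (x + y) z = cinner x z + cinner y z"
    and "cinner (c *\<^sub>C x) y = c * cinner x y"
    and "cinner x x = 0 \<longleftrightarrow> x = 0"
    by (simp_all add: cinner_complex_def scaleC_complex_def algebra_simps)
  show "0 \<le> Re (cinner x x)"
    by (simp add: cinner_complex_def)
  show "norm x = sqrt (Re (cinner x x))"
    by (simp add: cinner_complex_def cmod_def power2_eq_square)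
qed

end

definition bounded_clinear :: "('a::complex_inner \<Rightarrow> 'b::complex_inner) \<Rightarrow> bool"
  where "bounded_clinear f \<longleftrightarrow> bounded_linear f \<and> (\<forall>c x. f (c *\<^sub>C x) = c *\<^sub>C f x)"

section \<open>Conformable semigroups\<close>

text \<open>A family indexed by \<open>[0, \<infinity>)\<close> is a function on \<open>real\<close> whose values at negative
  arguments are unconstrained and never used.\<close>

definition conformable_semigroup ::
    "real \<Rightarrow> (real \<Rightarrow> 'a::complex_hilbert_space \<Rightarrow> 'a) \<Rightarrow> bool"
  where "conformable_semigroup \<delta> S \<longleftrightarrow>
    (\<forall>t\<ge>0. bounded_clinear (S t)) \<and>
    S 0 = id \<and>
    (\<forall>r\<ge>0. \<forall>q\<ge>0. S ((r + q) powr (1 / \<delta>)) = S (r powr (1 / \<delta>)) \<circ> S (q powr (1 / \<delta>)))"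

definition conformable_C0_semigroup ::
    "real \<Rightarrow> (real \<Rightarrow> 'a::complex_hilbert_space \<Rightarrow> 'a) \<Rightarrow> bool"
  where "conformable_C0_semigroup \<delta> S \<longleftrightarrow>
    conformable_semigroup \<delta> S \<and> (\<forall>x. ((\<lambda>t. S t x) \<longlongrightarrow> x) (at_right 0))"

text \<open>Only meant for \<open>t > 0\<close>.\<close>

definition has_conformable_derivative ::
    "real \<Rightarrow> (real \<Rightarrow> 'a::real_normed_vector) \<Rightarrow> 'a \<Rightarrow> real \<Rightarrow> bool"
  where "has_conformable_derivative \<delta> v d t \<longleftrightarrow>
    ((\<lambda>h. (v (t + h * t powr (1 - \<delta>)) - v t) /\<^sub>R h) \<longlongrightarrow> d) (at 0)"

definition conformable_deriv ::
    "real \<Rightarrow> (real \<Rightarrow> 'a::real_normed_vector) \<Rightarrow> real \<Rightarrow> 'a"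
  where "conformable_deriv \<delta> v t = (THE d. has_conformable_derivative \<delta> v d t)"

definition delta_generator_domain ::
    "real \<Rightarrow> (real \<Rightarrow> 'a::complex_hilbert_space \<Rightarrow> 'a) \<Rightarrow> 'a set"
  where "delta_generator_domain \<delta> S =
    {x. (\<forall>\<^sub>F t in at_right 0. \<exists>d. has_conformable_derivative \<delta> (\<lambda>s. S s x) d t) \<and>
        (\<exists>y. ((\<lambda>t. conformable_deriv \<delta> (\<lambda>s. S s x) t) \<longlongrightarrow> y) (at_right 0))}"

text \<open>Only meaningful on \<^const>\<open>delta_generator_domain\<close>.\<close>

definition delta_generator ::
    "real \<Rightarrow> (real \<Rightarrow> 'a::complex_hilbert_space \<Rightarrow> 'a) \<Rightarrow> 'a \<Rightarrow> 'a"
  where "delta_generator \<delta> S x =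
    Lim (at_right 0) (\<lambda>t. conformable_deriv \<delta> (\<lambda>s. S s x) t)"

text \<open>An unbounded operator is given by its domain together with a total function whose values
  outside the domain are irrelevant.\<close>

definition densely_defined :: "'a::complex_inner set \<Rightarrow> bool"
  where "densely_defined D \<longleftrightarrow> closure D = UNIV"

definition dissipative :: "'a::complex_inner set \<Rightarrow> ('a \<Rightarrow> 'a) \<Rightarrow> bool"
  where "dissipative D B \<longleftrightarrow> densely_defined D \<and> (\<forall>x\<in>D. Re (cinner (B x) x) \<le> 0)"

end

theory Submission
  imports Defs
begin

text \<open>Put \<open>T r = S (r powr (1 / \<delta>))\<close>. Then \<open>T\<close> is an ordinary \<open>C\<^sub>0\<close>-semigroup and the chain rule
  turns the conformable derivative of \<open>S t x\<close> into \<open>\<delta>\<close> times the derivative of \<open>T r x\<close> at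
  \<open>r = t powr \<delta>\<close>. For \<open>x\<close> in the domain, the semigroup law keeps the orbit \<open>T r x\<close> in the
  domain, and dissipativity makes the derivative of \<open>(norm (T r x))\<^sup>2\<close> nonpositive. Hence
  \<open>norm (T r x) \<le> norm x\<close> on the domain, and everywhere by density.\<close>

section \<open>The real part of the inner product\<close>

lemma cinner_add_right: "cinner x (y + z) = cinner x y + cinner x z"
  by (metis cinner_add_left cinner_commute complex_cnj_add)

lemma Re_cinner_commute: "Re (cinner x y) = Re (cinner y x)"
  by (metis cinner_commute complex_cnj(1) complex.sel(1) complex.collapse)

lemma Re_cinner_scaleR_left: "Re (cinner (r *\<^sub>R x) y) = r * Re (cinner x y)"
  by (simp add: scaleR_scaleC cinner_scaleC_left)

lemma Re_cinner_scaleR_right: "Re (cinner x (r *\<^sub>R y)) = r * Re (cinner x y)"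
  by (metis Re_cinner_commute Re_cinner_scaleR_left)

lemma norm_sq_eq_Re_cinner: "(norm x)\<^sup>2 = Re (cinner x x)"
  by (simp add: norm_eq_sqrt_cinner cinner_ge_zero)

text \<open>Cauchy-Schwarz is read off from the triangle inequality, which the norm already
  satisfies: expand the square of \<open>norm (x + y)\<close> and compare the cross terms.\<close>

lemma Re_cinner_le_norm: "Re (cinner x y) \<le> norm x * norm y"
proof -
  have "(norm (x + y))\<^sup>2 \<le> (norm x + norm y)\<^sup>2"
    by (intro power_mono norm_triangle_ineq) auto
  moreover have "(norm (x + y))\<^sup>2 = (norm x)\<^sup>2 + 2 * Re (cinner x y) + (norm y)\<^sup>2"
    using Re_cinner_commute[of x y]
    by (simp add: norm_sq_eq_Re_cinner cinner_add_left cinner_add_right)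
  ultimately show ?thesis
    by (simp add: power2_sum)
qed

lemma abs_Re_cinner_le_norm: "\<bar>Re (cinner x y)\<bar> \<le> norm x * norm y"
  using Re_cinner_le_norm[of x y] Re_cinner_le_norm[of "- x" y]
    Re_cinner_scaleR_left[of "- 1" x y] by simp

lemma bounded_bilinear_Re_cinner: "bounded_bilinear (\<lambda>x y. Re (cinner x y))"
proof
  show "\<exists>K. \<forall>x y :: 'a. norm (Re (cinner x y)) \<le> norm x * norm y * K"
    by (intro exI[of _ 1]) (simp add: abs_Re_cinner_le_norm)
qed (simp_all add: cinner_add_left cinner_add_right Re_cinner_scaleR_left Re_cinner_scaleR_right)

text \<open>The product rule for the bilinear form yields two cross terms; their real parts agree by
  conjugate symmetry, hence the factor 2.\<close>

lemma has_real_derivative_norm_sq: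
  fixes u :: "real \<Rightarrow> 'a::complex_inner"
  assumes "(u has_vector_derivative d) (at r)"
  shows "((\<lambda>s. (norm (u s))\<^sup>2) has_real_derivative 2 * Re (cinner d (u r))) (at r)"
  using bounded_bilinear.has_vector_derivative[OF bounded_bilinear_Re_cinner assms assms]
    Re_cinner_commute[of d "u r"]
  by (simp add: norm_sq_eq_Re_cinner has_real_derivative_iff_has_vector_derivative)

section \<open>Derivatives\<close>

text \<open>Both numbers are the right limit of the difference quotient at \<open>r\<close>:
  \<open>D\<close> by definition, \<open>L\<close> by l'Hopital's rule. The generator is defined
  through a right limit of derivatives, and this is how such a limit is matched with the derivative
  at a point. Being real-valued, the lemma is applied to the squared norm of an orbit and not to the
  orbit itself.\<close>

lemma has_derivative_eq_right_limit:
  fixes f :: "real \<Rightarrow> real"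
  assumes f: "(f has_real_derivative D) (at r)"
    and ev: "\<forall>\<^sub>F s in at_right 0. (f has_real_derivative g s) (at (r + s))"
    and g: "(g \<longlongrightarrow> L) (at_right 0)"
  shows "D = L"
proof -
  have "((\<lambda>s. f (r + s)) \<longlongrightarrow> f r) (at 0)"
    using DERIV_isCont[OF f] by (simp add: isCont_iff)
  then have "((\<lambda>s. f (r + s) - f r) \<longlongrightarrow> 0) (at_right 0)"
    by (intro LIM_zero) (simp add: filterlim_at_split)
  moreover have "((\<lambda>s. s) \<longlongrightarrow> (0::real)) (at_right 0)"
    by (rule tendsto_ident_at)
  moreover have "\<forall>\<^sub>F s in at_right 0. s \<noteq> (0::real)"
    by (auto simp: eventually_at_filter)
  moreover have "\<forall>\<^sub>F s in at_right 0. ((\<lambda>s. f (r + s) - f r) has_real_derivative g s) (at s)"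
    using ev by eventually_elim (auto simp: DERIV_shift add.commute intro!: derivative_eq_intros)
  ultimately have "((\<lambda>s. (f (r + s) - f r) / s) \<longlongrightarrow> L) (at_right 0)"
    by (intro lhopital_right_0[where f' = g and g' = "\<lambda>_. 1" and ?g0.0 = "\<lambda>s. s"]) (use g in auto)
  moreover have "((\<lambda>s. (f (r + s) - f r) / s) \<longlongrightarrow> D) (at_right 0)"
    using f by (simp add: DERIV_def filterlim_at_split)
  ultimately show ?thesis
    by (intro tendsto_unique[of "at_right (0::real)"]) auto
qed

lemma has_vector_derivative_at_iff_quotient:
  fixes f :: "real \<Rightarrow> 'a::real_normed_vector"
  shows "(f has_vector_derivative d) (at x) \<longleftrightarrow> ((\<lambda>h. (f (x + h) - f x) /\<^sub>R h) \<longlongrightarrow> d) (at 0)"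
proof -
  have "(f has_vector_derivative d) (at x) \<longleftrightarrow>
      ((\<lambda>h. norm (f (x + h) - f x - h *\<^sub>R d) / norm h) \<longlongrightarrow> 0) (at 0)"
    by (simp add: has_vector_derivative_def has_derivative_at bounded_linear_scaleR_left)
  also have "\<dots> \<longleftrightarrow> ((\<lambda>h. norm ((f (x + h) - f x) /\<^sub>R h - d)) \<longlongrightarrow> 0) (at 0)"
  proof (intro filterlim_cong refl)
    have "norm (f (x + h) - f x - h *\<^sub>R d) / norm h = norm ((f (x + h) - f x) /\<^sub>R h - d)"
      if "h \<noteq> 0" for h
    proof -
      have "(f (x + h) - f x) /\<^sub>R h - d = (f (x + h) - f x - h *\<^sub>R d) /\<^sub>R h"
        using that by (simp add: scaleR_diff_right)
      then show ?thesis by (simp add: divide_inverse_commute)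
    qed
    then show "\<forall>\<^sub>F h in at 0. norm (f (x + h) - f x - h *\<^sub>R d) / norm h =
        norm ((f (x + h) - f x) /\<^sub>R h - d)"
      by (auto simp: eventually_at_filter)
  qed
  also have "\<dots> \<longleftrightarrow> ((\<lambda>h. (f (x + h) - f x) /\<^sub>R h) \<longlongrightarrow> d) (at 0)"
    by (simp add: tendsto_norm_zero_iff LIM_zero_iff)
  finally show ?thesis .
qed

text \<open>For fixed \<open>t > 0\<close> the weight \<open>t powr (1 - \<delta>)\<close> is a
  positive constant, so the conformable quotient is an ordinary one with rescaled increment; the
  affine substitution is inverted for the converse.\<close>

lemma has_conformable_derivative_iff:
  fixes v :: "real \<Rightarrow> 'a::real_normed_vector"
  assumes t: "t > 0"
  shows "has_conformable_derivative \<delta> v d t \<longleftrightarrow>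
    (v has_vector_derivative d /\<^sub>R t powr (1 - \<delta>)) (at t)"
proof -
  define c where "c = t powr (1 - \<delta>)"
  have c: "c > 0" using t by (simp add: c_def)
  have "has_conformable_derivative \<delta> v d t \<longleftrightarrow>
      ((\<lambda>h. v (t + h * c)) has_vector_derivative d) (at 0)"
    by (simp add: has_conformable_derivative_def has_vector_derivative_at_iff_quotient c_def)
  also have "\<dots> \<longleftrightarrow> (v has_vector_derivative d /\<^sub>R c) (at t)"
  proof
    assume *: "((\<lambda>h. v (t + h * c)) has_vector_derivative d) (at 0)"
    have "((\<lambda>s. (s - t) / c) has_vector_derivative 1 / c) (at t)"
      unfolding has_real_derivative_iff_has_vector_derivative[symmetric]
      using c by (auto intro!: derivative_eq_intros)
    from vector_diff_chain_at[OF this, of "\<lambda>h. v (t + h * c)" d] *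
    show "(v has_vector_derivative d /\<^sub>R c) (at t)"
      using c by (simp add: o_def inverse_eq_divide)
  next
    assume *: "(v has_vector_derivative d /\<^sub>R c) (at t)"
    have "((\<lambda>h. t + h * c) has_vector_derivative c) (at 0)"
      unfolding has_real_derivative_iff_has_vector_derivative[symmetric]
      by (auto intro!: derivative_eq_intros)
    from vector_diff_chain_at[OF this, of v "d /\<^sub>R c"] *
    show "((\<lambda>h. v (t + h * c)) has_vector_derivative d) (at 0)"
      using c by (simp add: o_def)
  qed
  finally show ?thesis by (simp add: c_def)
qed

text \<open>The time change has derivative \<open>t powr (1 - \<delta>) / \<delta>\<close> at
  \<open>r\<close>, which cancels the conformable weight and leaves only the constant factor
  1/\<delta>. The inverse substitution is differentiable at \<open>t\<close> as well, which gives
  the converse.\<close>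

lemma has_conformable_derivative_iff_powr:
  fixes v :: "real \<Rightarrow> 'a::real_normed_vector"
  assumes \<delta>: "\<delta> > 0" and r: "r > 0"
  shows "has_conformable_derivative \<delta> v d (r powr (1 / \<delta>)) \<longleftrightarrow>
    ((\<lambda>s. v (s powr (1 / \<delta>))) has_vector_derivative d /\<^sub>R \<delta>) (at r)"
proof -
  define t where "t = r powr (1 / \<delta>)"
  have t: "t > 0" and r_eq: "r = t powr \<delta>"
    using r \<delta> by (auto simp: t_def powr_powr)
  have d1: "((\<lambda>s. s powr (1 / \<delta>)) has_vector_derivative (t powr (1 - \<delta>)) / \<delta>) (at r)"
    unfolding has_real_derivative_iff_has_vector_derivative[symmetric]
    using r \<delta> by (auto intro!: derivative_eq_intros simp: t_def powr_powr diff_divide_distrib)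
  have d2: "((\<lambda>s. s powr \<delta>) has_vector_derivative \<delta> * t powr (\<delta> - 1)) (at t)"
    unfolding has_real_derivative_iff_has_vector_derivative[symmetric]
    using t \<delta> by (auto intro!: derivative_eq_intros)
  show ?thesis
    unfolding t_def[symmetric] has_conformable_derivative_iff[OF t]
  proof
    assume "(v has_vector_derivative d /\<^sub>R t powr (1 - \<delta>)) (at t)"
    then have "(v \<circ> (\<lambda>s. s powr (1 / \<delta>)) has_vector_derivative
        ((t powr (1 - \<delta>)) / \<delta>) *\<^sub>R (d /\<^sub>R t powr (1 - \<delta>))) (at r)"
      by (intro vector_diff_chain_at d1) (simp add: t_def)
    then show "((\<lambda>s. v (s powr (1 / \<delta>))) has_vector_derivative d /\<^sub>R \<delta>) (at r)"
      using t \<delta> by (simp add: o_def field_simps)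
  next
    assume "((\<lambda>s. v (s powr (1 / \<delta>))) has_vector_derivative d /\<^sub>R \<delta>) (at r)"
    then have "((\<lambda>s. v (s powr (1 / \<delta>))) \<circ> (\<lambda>s. s powr \<delta>) has_vector_derivative
        (\<delta> * t powr (\<delta> - 1)) *\<^sub>R (d /\<^sub>R \<delta>)) (at t)"
      by (intro vector_diff_chain_at d2) (simp add: r_eq)
    moreover have "(\<delta> * t powr (\<delta> - 1)) *\<^sub>R (d /\<^sub>R \<delta>) = d /\<^sub>R t powr (1 - \<delta>)"
      using \<delta> powr_minus[of t "1 - \<delta>"] by simp
    ultimately have "((\<lambda>s. v (s powr (1 / \<delta>))) \<circ> (\<lambda>s. s powr \<delta>) has_vector_derivative
        d /\<^sub>R t powr (1 - \<delta>)) (at t)"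
      by (rule back_subst)
    \<comment> \<open>The two powers invert each other only on the positive reals, an open
      neighbourhood of \<open>t\<close>.\<close>
    then show "(v has_vector_derivative d /\<^sub>R t powr (1 - \<delta>)) (at t)"
      by (rule has_vector_derivative_transform_within_open[of _ _ _ "{0<..}"])
        (use t \<delta> in \<open>auto simp: powr_powr\<close>)
  qed
qed

lemma conformable_deriv_eq:
  assumes "has_conformable_derivative \<delta> v d t"
  shows "conformable_deriv \<delta> v t = d"
  unfolding conformable_deriv_def
  by (rule the_equality, rule assms)
    (use assms in \<open>auto simp: has_conformable_derivative_def intro: tendsto_unique[OF at_neq_bot]\<close>)

lemma filterlim_powr_at_right_0:
  assumes "a > 0"
  shows "filterlim (\<lambda>t::real. t powr a) (at_right 0) (at_right 0)"
proof -
  have "((\<lambda>t::real. t powr a) \<longlongrightarrow> 0) (at_right 0)"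
    using assms by (auto intro!: tendsto_eq_intros simp: eventually_at_filter)
  then show ?thesis
    by (auto simp: filterlim_at eventually_at_filter)
qed

section \<open>The time-changed semigroup\<close>

text \<open>The substitution \<open>r = t powr \<delta>\<close> tends to 0 from the right, so it
  carries both the eventual differentiability and the limit back to \<open>S\<close>. No derivative
  at time 0 itself is involved.\<close>

lemma delta_generator_domainI:
  assumes \<delta>: "\<delta> > 0"
    and ev: "\<forall>\<^sub>F r in at_right 0. ((\<lambda>s. S (s powr (1 / \<delta>)) x) has_vector_derivative d r) (at r)"
    and d: "(d \<longlongrightarrow> y) (at_right 0)"
  shows "x \<in> delta_generator_domain \<delta> S" and "delta_generator \<delta> S x = \<delta> *\<^sub>R y"
proof -
  have "\<forall>\<^sub>F r in at_right 0. has_conformable_derivative \<delta> (\<lambda>s. S s x) (\<delta> *\<^sub>R d r) (r powr (1 / \<delta>))"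
    using ev eventually_at_right_less
    by eventually_elim (use \<delta> in \<open>simp add: has_conformable_derivative_iff_powr\<close>)
  from eventually_compose_filterlim[OF this filterlim_powr_at_right_0[OF \<delta>]]
  have h: "\<forall>\<^sub>F t in at_right 0. has_conformable_derivative \<delta> (\<lambda>s. S s x) (\<delta> *\<^sub>R d (t powr \<delta>)) t"
    using eventually_at_right_less
    by eventually_elim (use \<delta> in \<open>simp add: powr_powr\<close>)
  have "((\<lambda>t. \<delta> *\<^sub>R d (t powr \<delta>)) \<longlongrightarrow> \<delta> *\<^sub>R y) (at_right 0)"
    by (intro tendsto_intros filterlim_compose[OF d] filterlim_powr_at_right_0 \<delta>)
  moreover have "\<forall>\<^sub>F t in at_right 0. \<delta> *\<^sub>R d (t powr \<delta>) = conformable_deriv \<delta> (\<lambda>s. S s x) t"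
    using h by eventually_elim (simp add: conformable_deriv_eq)
  ultimately have l: "((\<lambda>t. conformable_deriv \<delta> (\<lambda>s. S s x) t) \<longlongrightarrow> \<delta> *\<^sub>R y) (at_right 0)"
    by (rule Lim_transform_eventually)
  show "x \<in> delta_generator_domain \<delta> S"
    using h l by (auto simp: delta_generator_domain_def elim: eventually_mono)
  show "delta_generator \<delta> S x = \<delta> *\<^sub>R y"
    unfolding delta_generator_def using l by (intro tendsto_Lim) auto
qed

lemma delta_generator_domainE:
  assumes \<delta>: "\<delta> > 0" and x: "x \<in> delta_generator_domain \<delta> S"
  obtains d y
  where "\<forall>\<^sub>F r in at_right 0. ((\<lambda>s. S (s powr (1 / \<delta>)) x) has_vector_derivative d r) (at r)"
    and "(d \<longlongrightarrow> y) (at_right 0)"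
proof -
  let ?D = "conformable_deriv \<delta> (\<lambda>s. S s x)"
  have inv: "filterlim (\<lambda>r::real. r powr (1 / \<delta>)) (at_right 0) (at_right 0)"
    using \<delta> by (intro filterlim_powr_at_right_0) auto
  from x obtain y where ev: "\<forall>\<^sub>F t in at_right 0. \<exists>d. has_conformable_derivative \<delta> (\<lambda>s. S s x) d t"
    and y: "(?D \<longlongrightarrow> y) (at_right 0)"
    by (auto simp: delta_generator_domain_def)
  have "\<forall>\<^sub>F t in at_right 0. has_conformable_derivative \<delta> (\<lambda>s. S s x) (?D t) t"
    using ev by eventually_elim (auto simp: conformable_deriv_eq)
  from eventually_compose_filterlim[OF this inv]
  have "\<forall>\<^sub>F r in at_right 0. ((\<lambda>s. S (s powr (1 / \<delta>)) x) has_vector_derivative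
      ?D (r powr (1 / \<delta>)) /\<^sub>R \<delta>) (at r)"
    using eventually_at_right_less
    by eventually_elim (use \<delta> in \<open>simp add: has_conformable_derivative_iff_powr\<close>)
  moreover have "((\<lambda>r. ?D (r powr (1 / \<delta>)) /\<^sub>R \<delta>) \<longlongrightarrow> y /\<^sub>R \<delta>) (at_right 0)"
    by (intro tendsto_intros filterlim_compose[OF y] inv)
  ultimately show thesis by (rule that)
qed

text \<open>The curve \<open>T r (T s x)\<close> has derivative \<open>T r d\<close> because
  \<open>T r\<close> is bounded and linear. It can be read as the orbit of \<open>T r x\<close> at
  time \<open>s\<close>, since the operators commute, or as the orbit of \<open>x\<close> at time
  \<open>r + s\<close>.\<close>

lemma semigroup_orbit_derivative_shift:
  fixes T :: "real \<Rightarrow> 'a::real_normed_vector \<Rightarrow> 'a"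
  assumes semigroup: "\<And>r q x. r \<ge> 0 \<Longrightarrow> q \<ge> 0 \<Longrightarrow> T (r + q) x = T r (T q x)"
    and lin: "bounded_linear (T r)" and r: "r \<ge> 0" and s: "s > 0"
    and deriv: "((\<lambda>s. T s x) has_vector_derivative d) (at s)"
  shows "((\<lambda>s. T s (T r x)) has_vector_derivative T r d) (at s)"
    and "((\<lambda>s. T s x) has_vector_derivative T r d) (at (r + s))"
proof -
  have D: "((\<lambda>s. T r (T s x)) has_vector_derivative T r d) (at s)"
    by (rule bounded_linear.has_vector_derivative[OF lin deriv])
  have "T r (T q x) = T q (T r x)" if "q > 0" for q
    using semigroup[of r q x] semigroup[of q r x] that r by (simp add: add.commute)
  then show "((\<lambda>s. T s (T r x)) has_vector_derivative T r d) (at s)"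
    by (intro has_vector_derivative_transform_within_open[OF D, of "{0<..}"]) (use s in auto)
  have "((\<lambda>z. z - r) has_vector_derivative 1) (at (r + s))"
    by (auto intro!: derivative_eq_intros)
  from vector_diff_chain_at[OF this, of "\<lambda>s. T r (T s x)" "T r d"] D
  have "((\<lambda>z. T r (T (z - r) x)) has_vector_derivative T r d) (at (r + s))"
    by (simp add: o_def)
  moreover have "T r (T (z - r) x) = T z x" if "z > r" for z
    using semigroup[of r "z - r" x] that r by simp
  ultimately show "((\<lambda>s. T s x) has_vector_derivative T r d) (at (r + s))"
    by (elim has_vector_derivative_transform_within_open[of _ _ _ "{r<..}"]) (use s in auto)
qed

text \<open>With \<open>y\<close> the right limit at 0 of the derivatives of \<open>T s x\<close>,
  the derivative of the squared norm at \<open>r > 0\<close> is shown to be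
  \<open>2 * Re (cinner (T r y) (T r x))\<close>, without first identifying the derivative of the
  orbit at \<open>r\<close> with \<open>T r y\<close>.\<close>

lemma norm_le_on_delta_generator_domain:
  fixes S :: "real \<Rightarrow> 'a::complex_hilbert_space \<Rightarrow> 'a"
  assumes \<delta>: "\<delta> > 0" and S: "conformable_C0_semigroup \<delta> S"
    and diss: "dissipative (delta_generator_domain \<delta> S) (delta_generator \<delta> S)"
    and x: "x \<in> delta_generator_domain \<delta> S" and t: "t \<ge> 0"
  shows "norm (S t x) \<le> norm x"
proof -
  define T where "T r = S (r powr (1 / \<delta>))" for r
  have T_add: "T (r + q) y = T r (T q y)" if "r \<ge> 0" "q \<ge> 0" for r q y
    using S that by (simp add: T_def conformable_C0_semigroup_def conformable_semigroup_def)
  \<comment> \<open>No sign condition on \<open>r\<close> is required, because \<open>powr\<close>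
    never takes negative values.\<close>
  have lin: "bounded_linear (T r)" for r
    using S by (simp add: T_def conformable_C0_semigroup_def conformable_semigroup_def bounded_clinear_def)
  have T_0: "T 0 = id"
    using S by (simp add: T_def conformable_C0_semigroup_def conformable_semigroup_def)
  have T_cont0: "((\<lambda>s. T s y) \<longlongrightarrow> y) (at_right 0)" for y
    unfolding T_def using S \<delta>
    by (intro filterlim_compose[OF _ filterlim_powr_at_right_0])
      (auto simp: conformable_C0_semigroup_def)
  obtain d y where d: "\<forall>\<^sub>F r in at_right 0. ((\<lambda>s. T s x) has_vector_derivative d r) (at r)"
    and y: "(d \<longlongrightarrow> y) (at_right 0)"
    using delta_generator_domainE[OF \<delta> x] unfolding T_def by blast
  have d_pos: "\<forall>\<^sub>F s in at_right 0. s > 0 \<and> ((\<lambda>s. T s x) has_vector_derivative d s) (at s)"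
    using d eventually_at_right_less by (rule eventually_elim2) simp
  have orbit: "\<forall>\<^sub>F s in at_right 0. ((\<lambda>s. T s (T r x)) has_vector_derivative T r (d s)) (at s)"
    if "r \<ge> 0" for r
    using d_pos
    by (rule eventually_mono) (use semigroup_orbit_derivative_shift(1)[of T, OF T_add lin that] in blast)
  have shift: "\<forall>\<^sub>F s in at_right 0. ((\<lambda>s. T s x) has_vector_derivative T r (d s)) (at (r + s))"
    if "r \<ge> 0" for r
    using d_pos
    by (rule eventually_mono) (use semigroup_orbit_derivative_shift(2)[of T, OF T_add lin that] in blast)
  have Td: "((\<lambda>s. T r (d s)) \<longlongrightarrow> T r y) (at_right 0)" for r
    by (rule bounded_linear.tendsto[OF lin y])
  \<comment> \<open>The shifted orbit shows that \<open>T r x\<close> lies in the domain with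
    generator value \<open>\<delta> *\<^sub>R T r y\<close>, so dissipativity applies at
    \<open>T r x\<close>.\<close>
  have nonpos: "Re (cinner (T r y) (T r x)) \<le> 0" if r: "r \<ge> 0" for r
  proof -
    note gen = delta_generator_domainI[OF \<delta>, of S "T r x" "\<lambda>s. T r (d s)" "T r y",
        folded T_def, OF orbit[OF r] Td]
    have "Re (cinner (\<delta> *\<^sub>R T r y) (T r x)) \<le> 0"
      using diss gen unfolding dissipative_def by metis
    then show ?thesis
      using \<delta> by (simp add: Re_cinner_scaleR_left mult_le_0_iff)
  qed
  let ?f = "\<lambda>s. (norm (T s x))\<^sup>2"
  have decreasing: "\<exists>D. (?f has_real_derivative D) (at r) \<and> D \<le> 0" if r: "r > 0" for r
  proof -
    \<comment> \<open>Differentiability is known only at small times; a small \<open>s < r\<close>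
      is chosen and the derivative is transported to \<open>r\<close> by
      \<open>T (r - s)\<close>.\<close>
    have "\<forall>\<^sub>F s in at_right 0. 0 < s \<and> s < r \<and> ((\<lambda>s. T s x) has_vector_derivative d s) (at s)"
      using d_pos eventually_at_right_real[OF r] by eventually_elim auto
    then obtain s where s: "0 < s" "s < r" "((\<lambda>s. T s x) has_vector_derivative d s) (at s)"
      using eventually_happens'[of "at_right (0::real)"] by (auto simp: trivial_limit_at_right_real)
    then obtain D where D: "((\<lambda>s. T s x) has_vector_derivative D) (at r)"
      using semigroup_orbit_derivative_shift(2)[of T, OF T_add lin, of "r - s" s] by auto
    note f = has_real_derivative_norm_sq[OF D]
    have ev: "\<forall>\<^sub>F s in at_right 0. (?f has_real_derivative
        2 * Re (cinner (T r (d s)) (T (r + s) x))) (at (r + s))"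
      using shift[OF less_imp_le[OF r]] by eventually_elim (rule has_real_derivative_norm_sq)
    \<comment> \<open>Right continuity of the orbit at \<open>r\<close> is strong continuity at 0
      with \<open>T r\<close> applied to it.\<close>
    have "\<forall>\<^sub>F s in at_right 0. T r (T s x) = T (r + s) x"
      using eventually_at_right_less[of 0] by eventually_elim (use r in \<open>simp add: T_add\<close>)
    with bounded_linear.tendsto[OF lin T_cont0]
    have "((\<lambda>s. T (r + s) x) \<longlongrightarrow> T r x) (at_right 0)"
      by (rule Lim_transform_eventually)
    from tendsto_mult_left[OF bounded_bilinear.tendsto[OF bounded_bilinear_Re_cinner Td this], of 2]
    have "((\<lambda>s. 2 * Re (cinner (T r (d s)) (T (r + s) x))) \<longlongrightarrow>
        2 * Re (cinner (T r y) (T r x))) (at_right 0)" .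
    from has_derivative_eq_right_limit[OF f ev this] nonpos[of r] r
    have "2 * Re (cinner D (T r x)) \<le> 0" by simp
    with f show ?thesis by blast
  qed
  define q where "q = t powr \<delta>"
  have q: "q \<ge> 0" and Tq: "T q = S t"
    using \<delta> t by (auto simp: q_def T_def powr_powr)
  \<comment> \<open>Derivatives are available at positive times only; at the endpoint 0 strong
    continuity together with \<open>T 0 = id\<close> supplies the continuity that the monotonicity
    criterion asks for.\<close>
  have "?f q \<le> ?f 0"
  proof (rule DERIV_nonpos_imp_decreasing_open[OF q])
    show "\<exists>D. (?f has_real_derivative D) (at r) \<and> D \<le> 0" if "0 < r" for r
      by (rule decreasing[OF that])
    have "(?f \<longlongrightarrow> ?f 0) (at_right 0)"
      by (intro tendsto_intros) (use T_cont0 T_0 in auto)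
    moreover have "(?f \<longlongrightarrow> ?f r) (at r)" if "r > 0" for r
      using decreasing[OF that] DERIV_isCont isCont_def by blast
    ultimately have "(?f \<longlongrightarrow> ?f r) (at r within {0..q})" if "r \<in> {0..q}" for r
    proof (cases "r = 0")
      case True
      have "at 0 within {0..q} \<le> at_right 0"
        by (auto simp: le_filter_def eventually_at_filter elim!: eventually_mono)
      with \<open>(?f \<longlongrightarrow> ?f 0) (at_right 0)\<close> show ?thesis
        unfolding True by (rule tendsto_mono[rotated])
    next
      case False
      then show ?thesis
        using that \<open>\<And>r. r > 0 \<Longrightarrow> (?f \<longlongrightarrow> ?f r) (at r)\<close>[of r]
        by (auto elim: tendsto_within_subset)
    qed
    then show "continuous_on {0..q} ?f"
      by (simp add: continuous_on_def)
  qed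
  then have "?f q \<le> (norm x)\<^sup>2" by (simp add: T_0)
  then show ?thesis by (simp add: Tq power2_le_iff_abs_le)
qed

theorem corollary1:
  fixes S :: "real \<Rightarrow> 'a::complex_hilbert_space \<Rightarrow> 'a" and \<delta> :: real
  assumes "0 < \<delta>" and "\<delta> \<le> 1"
    and "conformable_C0_semigroup \<delta> S"
    and "densely_defined (delta_generator_domain \<delta> S)"
    and "dissipative (delta_generator_domain \<delta> S) (delta_generator \<delta> S)"
    and "\<exists>l>0. (\<lambda>x. l *\<^sub>R x - delta_generator \<delta> S x) ` delta_generator_domain \<delta> S = UNIV"
  shows "\<forall>t\<ge>0. onorm (S t) \<le> 1"
proof (intro allI impI)
  fix t :: real
  assume t: "t \<ge> 0"
  have lin: "bounded_linear (S t)"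
    using assms(3) t
    by (simp add: conformable_C0_semigroup_def conformable_semigroup_def bounded_clinear_def)
  \<comment> \<open>The set of vectors on which \<open>S t\<close> does not increase the norm is
    closed and contains the dense domain, hence is the whole space.\<close>
  have "closed {x. norm (S t x) \<le> norm x}"
    by (intro closed_Collect_le continuous_intros linear_continuous_on[OF lin])
  moreover have "delta_generator_domain \<delta> S \<subseteq> {x. norm (S t x) \<le> norm x}"
    using norm_le_on_delta_generator_domain[OF assms(1,3,5) _ t] by auto
  ultimately have "closure (delta_generator_domain \<delta> S) \<subseteq> {x. norm (S t x) \<le> norm x}"
    by (rule closure_minimal[rotated])
  then have "norm (S t x) \<le> 1 * norm x" for x
    using assms(4) by (auto simp: densely_defined_def)
  then show "onorm (S t) \<le> 1"
    by (rule onorm_bound[rotated]) simp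
qed

end
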